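(* (1) Let $n,r$ be positive integers. Then there exists $N$ such that for all integers $s,t$ with $s>t\ge N$ (so in particular $s>t\ge1$ and $(s,-t)\ne(2,-1)$), $$\left\lfloor \left(\sum_{k=n}^\infty \frac{1}{f_{rk}(s,-t)}\right)^{-1}\right\rfloor = f_{rn}(s,-t)-f_{r(n-1)}(s,-t)-1.$$ (2) Let $n,r$ be positive integers. Then there exists $S$ such that for all integers $s\ge S$, $$\left\lfloor \left(\sum_{k=n}^\infty \frac{1}{f_{rk}(s,-1)^2}\right)^{-1}\right\rfloor = f_{rn}(s,-1)^2-f_{r(n-1)}(s,-1)^2-1.$$
   Context: For integers $s,t$, the generalized Fibonacci sequence is $f_0(s,t)=0$, $f_1(s,t)=1$, $f_n(s,t)=s f_{n-1}(s,t)+t f_{n-2}(s,t)$ for $n\ge2$. $\lfloor x\rfloor$ denotes the floor of a real number $x$. (The paper phrases the hypotheses as "if $s,t$ are sufficiently large" and "if $s$ is sufficiently large", for fixed $n,r$.) *)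

theory Defs
  imports Complex_Main
begin

fun gfib :: "int \<Rightarrow> int \<Rightarrow> nat \<Rightarrow> int" where
  "gfib s t 0 = 0"
| "gfib s t (Suc 0) = 1"
| "gfib s t (Suc (Suc n)) = s * gfib s t (Suc n) + t * gfib s t n"

end

theory Submission
  imports Defs
begin

text \<open>
  Write \<open>\<Delta>\<close> for the forward difference of a sequence \<open>q\<close> and \<open>T k = q (k + 1)\<^sup>2 - q k * q (k + 2)\<close>.
  Where \<open>\<Delta>\<close> exceeds a constant \<open>c\<close>, the difference of \<open>1 / (\<Delta> k - c) - 1 / (\<Delta> (k + 1) - c)\<close> and
  \<open>1 / q (k + 1)\<close> has the sign of \<open>c * (q (k + 2) - q k - c) - T k\<close>.  It is negative for \<open>c = 0\<close> if
  \<open>T\<close> is positive, and nonnegative for \<open>c = 1\<close> if \<open>T k\<close> is at most half of \<open>q (k + 2)\<close> and \<open>q\<close> at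
  least doubles in each step.  Telescoping then puts the inverse of \<open>\<Sum>k. 1 / q (k + 1)\<close> into the
  interval from \<open>\<Delta> 0 - 1\<close> to \<open>\<Delta> 0\<close>.

  If \<open>q\<close> runs through the generalized Fibonacci numbers along an arithmetic progression of step \<open>r\<close>,
  Catalan's identity evaluates \<open>T\<close>, and \<open>f (m + r) \<ge> (s - 2) * f m * f r\<close> supplies the growth.  The
  squares \<open>q\<^sup>2\<close> reduce to \<open>q\<close>, as replacing \<open>q\<close> by \<open>q\<^sup>2\<close> turns \<open>T k\<close> into
  \<open>T k * (2 * q (k + 1)\<^sup>2 - T k)\<close>.  The threshold 4 serves in both parts, for all \<open>n\<close> and \<open>r\<close>.
\<close>

section \<open>Reciprocal sums of log-concave sequences\<close>

definition forward_diff :: "(nat \<Rightarrow> 'a::ab_group_add) \<Rightarrow> nat \<Rightarrow> 'a" where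
  "forward_diff q k = q (Suc k) - q k"

definition turanian :: "(nat \<Rightarrow> 'a::comm_ring_1) \<Rightarrow> nat \<Rightarrow> 'a" where
  "turanian q k = (q (Suc k))\<^sup>2 - q k * q (Suc (Suc k))"

lemma turanian_of_int: "turanian (\<lambda>k. of_int (q k)) k = of_int (turanian q k)"
  by (simp add: turanian_def)

lemma turanian_square:
  "turanian (\<lambda>k. (q k)\<^sup>2) k = turanian q k * (2 * (q (Suc k))\<^sup>2 - turanian q k)"
  by (simp add: turanian_def power2_eq_square algebra_simps)

lemma reciprocal_forward_diff_telescope:
  fixes q :: "nat \<Rightarrow> 'a::field"
  assumes "forward_diff q k \<noteq> c" and "forward_diff q (Suc k) \<noteq> c" and "q (Suc k) \<noteq> 0"
  shows "1 / (forward_diff q k - c) - 1 / (forward_diff q (Suc k) - c) - 1 / q (Suc k)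
    = (c * (q (Suc (Suc k)) - q k - c) - turanian q k)
      / ((forward_diff q k - c) * (forward_diff q (Suc k) - c) * q (Suc k))"
proof -
  define x y where "x = forward_diff q k - c" and "y = forward_diff q (Suc k) - c"
  have "x \<noteq> 0" "y \<noteq> 0"
    using assms by (simp_all add: x_def y_def)
  then have "1 / x - 1 / y - 1 / q (Suc k) = ((y - x) * q (Suc k) - x * y) / (x * y * q (Suc k))"
    using assms(3) by (simp add: field_simps)
  also have "(y - x) * q (Suc k) - x * y = c * (q (Suc (Suc k)) - q k - c) - turanian q k"
    unfolding x_def y_def forward_diff_def turanian_def
    by (simp add: algebra_simps power2_eq_square)
  finally show ?thesis
    unfolding x_def y_def .
qed

lemma telescope_reciprocal_sums:
  fixes h :: "nat \<Rightarrow> 'a::real_normed_field"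
  assumes "filterlim h at_infinity sequentially"
  shows "(\<lambda>k. 1 / h k - 1 / h (Suc k)) sums (1 / h 0)"
proof -
  have "(\<lambda>k. 1 / h k) \<longlonglongrightarrow> 0"
    using tendsto_inverse_0 assms unfolding divide_inverse mult_1_left by (rule filterlim_compose)
  from telescope_sums'[OF this] show ?thesis
    by simp
qed

locale doubling_sequence =
  fixes q :: "nat \<Rightarrow> 'a::linordered_idom"
  assumes nonneg_0: "0 \<le> q 0"
    and pos_1: "0 < q (Suc 0)"
    and doubling: "2 * q k \<le> q (Suc k)"
begin

lemma power_growth: "q (Suc 0) * 2 ^ k \<le> q (Suc k)"
proof (induction k)
  case (Suc k)
  then show ?case
    using doubling[of "Suc k"] by (simp add: mult.left_commute)
qed simp

lemma pos_Suc: "0 < q (Suc k)"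
proof (induction k)
  case (Suc k)
  then show ?case
    using doubling[of "Suc k"] by linarith
qed (rule pos_1)

lemma nonneg: "0 \<le> q k"
  using nonneg_0 pos_Suc by (cases k) (auto intro: less_imp_le)

lemma less_Suc: "q k < q (Suc k)"
  using doubling[of k] nonneg[of k] pos_Suc[of k] by linarith

lemma Suc_le_double_forward_diff: "q (Suc k) \<le> 2 * forward_diff q k"
  using doubling[of k] by (simp add: forward_diff_def)

lemma forward_diff_pos: "0 < forward_diff q k"
  using less_Suc by (simp add: forward_diff_def)

lemma mono_forward_diff: "mono (forward_diff q)"
proof (rule incseq_SucI)
  show "forward_diff q n \<le> forward_diff q (Suc n)" for n
    using doubling[of "Suc n"] nonneg[of n] by (simp add: forward_diff_def)
qed

lemma doubling_sequence_square: "doubling_sequence (\<lambda>k. (q k)\<^sup>2)"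
proof
  fix k
  have "2 * (q k)\<^sup>2 \<le> (2 * q k)\<^sup>2"
    by (simp add: power_mult_distrib)
  also have "\<dots> \<le> (q (Suc k))\<^sup>2"
    using doubling nonneg by (intro power_mono) simp_all
  finally show "2 * (q k)\<^sup>2 \<le> (q (Suc k))\<^sup>2" .
qed (use pos_1 in simp_all)

end

lemma doubling_sequence_of_int:
  assumes "doubling_sequence q"
  shows "doubling_sequence (\<lambda>k. real_of_int (q k))"
proof -
  interpret doubling_sequence q by fact
  show ?thesis
  proof
    show "2 * real_of_int (q k) \<le> real_of_int (q (Suc k))" for k
      using doubling[of k] by linarith
  qed (use nonneg_0 pos_1 in simp_all)
qed

context
  fixes q :: "nat \<Rightarrow> real"
  assumes doubling_seq: "doubling_sequence q"
begin

interpretation doubling_sequence q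
  by (fact doubling_seq)

lemma summable_reciprocal: "summable (\<lambda>k. 1 / q (Suc k))"
proof (rule summable_comparison_test')
  show "summable (\<lambda>k. 1 / q (Suc 0) * (1 / 2) ^ k)"
    by (intro summable_mult summable_geometric) simp
  show "norm (1 / q (Suc k)) \<le> 1 / q (Suc 0) * (1 / 2) ^ k" if "0 \<le> k" for k
    using power_growth[of k] pos_1 pos_Suc[of k] by (simp add: power_one_over frac_le)
qed

lemma suminf_reciprocal_pos: "0 < (\<Sum>k. 1 / q (Suc k))"
  using summable_reciprocal pos_Suc by (intro suminf_pos) simp_all

lemma forward_diff_at_top: "filterlim (forward_diff q) at_top sequentially"
proof (rule filterlim_at_top_mono)
  have "filterlim (\<lambda>k. 2 ^ k :: real) at_top sequentially"
    using filterlim_at_infinity_imp_norm_at_top[OF filterlim_realpow_sequentially_gt1[of "2::real"]]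
    by (simp add: norm_power)
  then show "filterlim (\<lambda>k. q (Suc 0) / 2 * 2 ^ k) at_top sequentially"
    using pos_1 by (intro filterlim_tendsto_pos_mult_at_top[OF tendsto_const]) simp_all
  show "\<forall>\<^sub>F k in sequentially. q (Suc 0) / 2 * 2 ^ k \<le> forward_diff q k"
  proof (intro always_eventually allI)
    show "q (Suc 0) / 2 * 2 ^ k \<le> forward_diff q k" for k
      using power_growth[of k] Suc_le_double_forward_diff[of k] by simp
  qed
qed

lemma telescope_forward_diff_sums:
  "(\<lambda>k. 1 / (forward_diff q k - c) - 1 / (forward_diff q (Suc k) - c))
    sums (1 / (forward_diff q 0 - c))"
proof (rule telescope_reciprocal_sums)
  have "filterlim (\<lambda>k. - c + forward_diff q k) at_top sequentially"
    using tendsto_const forward_diff_at_top by (rule filterlim_tendsto_add_at_top)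
  then show "filterlim (\<lambda>k. forward_diff q k - c) at_infinity sequentially"
    by (simp add: filterlim_at_top_imp_at_infinity)
qed

lemma inverse_suminf_reciprocal_less:
  assumes log_concave: "\<And>k. 0 < turanian q k"
  shows "inverse (\<Sum>k. 1 / q (Suc k)) < forward_diff q 0"
proof -
  define gap where
    "gap k = 1 / q (Suc k) - (1 / forward_diff q k - 1 / forward_diff q (Suc k))" for k
  have "0 < gap k" for k
  proof -
    have "- gap k = - turanian q k / (forward_diff q k * forward_diff q (Suc k) * q (Suc k))"
      using reciprocal_forward_diff_telescope[of q k 0] forward_diff_pos[THEN less_imp_neq]
        pos_Suc[of k]
      by (simp add: gap_def)
    also have "\<dots> < 0"
      using log_concave forward_diff_pos pos_Suc by (simp add: divide_less_0_iff)
    finally show ?thesis by simp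
  qed
  moreover have "gap sums ((\<Sum>k. 1 / q (Suc k)) - 1 / forward_diff q 0)"
    using sums_diff[OF summable_sums[OF summable_reciprocal] telescope_forward_diff_sums[of 0]]
    by (simp add: gap_def[abs_def])
  ultimately have "1 / forward_diff q 0 < (\<Sum>k. 1 / q (Suc k))"
    using suminf_pos[of gap] by (simp add: sums_iff)
  then show ?thesis
    using suminf_reciprocal_pos forward_diff_pos[of 0] by (simp add: field_simps)
qed

lemma inverse_suminf_reciprocal_ge:
  assumes turanian_le: "\<And>k. turanian q k \<le> c * (q (Suc (Suc k)) - q k - c)"
  shows "forward_diff q 0 - c \<le> inverse (\<Sum>k. 1 / q (Suc k))"
proof (cases "forward_diff q 0 \<le> c")
  case True
  then show ?thesis
    using positive_imp_inverse_positive[OF suminf_reciprocal_pos] by linarith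
next
  case False
  then have diff_gt: "c < forward_diff q k" for k
    using monoD[OF mono_forward_diff, of 0 k] by simp
  have "1 / q (Suc k) \<le> 1 / (forward_diff q k - c) - 1 / (forward_diff q (Suc k) - c)" for k
  proof -
    have "0 \<le> (c * (q (Suc (Suc k)) - q k - c) - turanian q k)
        / ((forward_diff q k - c) * (forward_diff q (Suc k) - c) * q (Suc k))"
      using turanian_le[of k] diff_gt[THEN less_imp_le] nonneg by simp
    also have "\<dots> = 1 / (forward_diff q k - c) - 1 / (forward_diff q (Suc k) - c) - 1 / q (Suc k)"
      using diff_gt[THEN less_imp_neq] pos_Suc[of k]
      by (intro reciprocal_forward_diff_telescope[symmetric]) auto
    finally show ?thesis by simp
  qed
  then have "(\<Sum>k. 1 / q (Suc k)) \<le> 1 / (forward_diff q 0 - c)"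
    using summable_sums[OF summable_reciprocal] telescope_forward_diff_sums by (rule sums_le)
  then show ?thesis
    using suminf_reciprocal_pos diff_gt[of 0] by (simp add: field_simps)
qed

end

lemma floor_inverse_suminf_reciprocal:
  fixes q :: "nat \<Rightarrow> int"
  assumes doubling_seq: "doubling_sequence q"
    and log_concave: "\<And>k. 0 < turanian q k"
    and turanian_le: "\<And>k. 2 * turanian q k \<le> q (Suc (Suc k))"
  shows "\<lfloor>inverse (\<Sum>k. 1 / real_of_int (q (Suc k)))\<rfloor> = q (Suc 0) - q 0 - 1"
proof -
  interpret doubling_sequence q by fact
  let ?q = "\<lambda>k. real_of_int (q k)"
  have "inverse (\<Sum>k. 1 / ?q (Suc k)) < forward_diff ?q 0"
    using doubling_sequence_of_int[OF doubling_seq] log_concave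
    by (intro inverse_suminf_reciprocal_less) (simp_all add: turanian_of_int)
  moreover have "forward_diff ?q 0 - 1 \<le> inverse (\<Sum>k. 1 / ?q (Suc k))"
  proof (intro inverse_suminf_reciprocal_ge doubling_sequence_of_int doubling_seq)
    fix k
    have "turanian q k \<le> q (Suc (Suc k)) - q k - 1"
      using turanian_le[of k] doubling[of "Suc k"] less_Suc[of k] by linarith
    then have "real_of_int (turanian q k) \<le> real_of_int (q (Suc (Suc k)) - q k - 1)"
      by (simp only: of_int_le_iff)
    then show "turanian ?q k \<le> 1 * (?q (Suc (Suc k)) - ?q k - 1)"
      by (simp add: turanian_of_int)
  qed
  ultimately show ?thesis
    by (intro floor_unique) (simp_all add: forward_diff_def)
qed

section \<open>Generalized Fibonacci numbers\<close>

lemma gfib_add: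
  "gfib s t (Suc (m + n)) = gfib s t (Suc m) * gfib s t (Suc n) + t * gfib s t m * gfib s t n"
proof (induction s t m rule: gfib.induct)
  case (3 s t m)
  have "gfib s t (Suc (Suc (Suc m) + n))
      = s * gfib s t (Suc (Suc m + n)) + t * gfib s t (Suc (m + n))"
    by simp
  also have "\<dots> = gfib s t (Suc (Suc (Suc m))) * gfib s t (Suc n)
      + t * gfib s t (Suc (Suc m)) * gfib s t n"
    unfolding 3 by (simp add: algebra_simps)
  finally show ?case .
qed simp_all

lemma gfib_d_Ocagne:
  "gfib s t (Suc m) * gfib s t (m + j) - gfib s t m * gfib s t (Suc (m + j))
    = (- t) ^ m * gfib s t j"
proof (induction m)
  case (Suc m)
  have "gfib s t (Suc (Suc m)) * gfib s t (Suc m + j)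
        - gfib s t (Suc m) * gfib s t (Suc (Suc m + j))
      = - t * (gfib s t (Suc m) * gfib s t (m + j) - gfib s t m * gfib s t (Suc (m + j)))"
    by (simp add: algebra_simps)
  then show ?case
    unfolding Suc by simp
qed simp

lemma gfib_Vajda:
  "gfib s t (m + i) * gfib s t (m + j) - gfib s t m * gfib s t (m + i + j)
    = (- t) ^ m * gfib s t i * gfib s t j"
proof (induction s t i rule: gfib.induct)
  case (2 s t)
  then show ?case
    using gfib_d_Ocagne[of s t m j] by simp
next
  case (3 s t i)
  have "gfib s t (m + Suc (Suc i)) * gfib s t (m + j) - gfib s t m * gfib s t (m + Suc (Suc i) + j)
     = s * (gfib s t (m + Suc i) * gfib s t (m + j) - gfib s t m * gfib s t (m + Suc i + j))
     + t * (gfib s t (m + i) * gfib s t (m + j) - gfib s t m * gfib s t (m + i + j))"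
    by (simp add: algebra_simps)
  then show ?case
    unfolding 3 by (simp add: algebra_simps)
qed simp

definition gfib_progression :: "int \<Rightarrow> int \<Rightarrow> nat \<Rightarrow> nat \<Rightarrow> nat \<Rightarrow> int" where
  "gfib_progression s t m r k = gfib s t (m + r * k)"

lemma gfib_progression_Suc: "gfib_progression s t m r (Suc k) = gfib s t (m + r * k + r)"
  by (simp add: gfib_progression_def algebra_simps)

lemma turanian_gfib_progression:
  "turanian (gfib_progression s t m r) k = (- t) ^ (m + r * k) * (gfib s t r)\<^sup>2"
  using gfib_Vajda[of s t "m + r * k" r r]
  by (simp add: turanian_def gfib_progression_def power2_eq_square algebra_simps)

context
  fixes s t :: int
  assumes t_pos: "0 < t" and t_less: "t < s"
begin

lemma gfib_nonneg_and_mult_le: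
  "0 \<le> gfib s (- t) m \<and> t * gfib s (- t) m \<le> gfib s (- t) (Suc m)"
proof (induction m)
  case (Suc m)
  then have nonneg: "0 \<le> gfib s (- t) (Suc m)"
    using t_pos by (meson mult_nonneg_nonneg less_imp_le order_trans)
  then have "(t + 1) * gfib s (- t) (Suc m) \<le> s * gfib s (- t) (Suc m)"
    using t_less by (intro mult_right_mono) auto
  with Suc nonneg show ?case
    by (simp add: algebra_simps)
qed simp

lemmas gfib_nonneg = gfib_nonneg_and_mult_le[THEN conjunct1]
lemmas mult_gfib_le_gfib_Suc = gfib_nonneg_and_mult_le[THEN conjunct2]

lemma gfib_Suc_pos: "0 < gfib s (- t) (Suc m)"
proof (induction m)
  case (Suc m)
  then show ?case
    using mult_gfib_le_gfib_Suc t_pos by (meson mult_pos_pos less_le_trans)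
qed simp

lemma gfib_pos: "0 < m \<Longrightarrow> 0 < gfib s (- t) m"
  using gfib_Suc_pos by (cases m) simp_all

lemma diff_one_mult_gfib_le_gfib_Suc: "(s - 1) * gfib s (- t) m \<le> gfib s (- t) (Suc m)"
  using mult_gfib_le_gfib_Suc[of "m - 1"] by (cases m) (simp_all add: algebra_simps)

lemma power_mult_gfib_le_gfib_add: "t ^ j * gfib s (- t) m \<le> gfib s (- t) (j + m)"
proof (induction j)
  case (Suc j)
  then have "t * (t ^ j * gfib s (- t) m) \<le> t * gfib s (- t) (j + m)"
    using t_pos by (intro mult_left_mono) auto
  then show ?case
    using mult_gfib_le_gfib_Suc[of "j + m"] by (simp add: mult.assoc)
qed simp

lemma diff_two_mult_gfib_mult_le_gfib_add:
  "(s - 2) * (gfib s (- t) m * gfib s (- t) r) \<le> gfib s (- t) (m + r)"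
proof (cases r)
  case (Suc i)
  have "(s - 1) * gfib s (- t) m * gfib s (- t) r \<le> gfib s (- t) (Suc m) * gfib s (- t) r"
    using diff_one_mult_gfib_le_gfib_Suc gfib_nonneg by (intro mult_right_mono)
  moreover have "gfib s (- t) m * (t * gfib s (- t) i) \<le> gfib s (- t) m * gfib s (- t) r"
    using mult_gfib_le_gfib_Suc gfib_nonneg Suc by (intro mult_left_mono) auto
  ultimately show ?thesis
    using gfib_add[of s "- t" m i] Suc by (simp add: algebra_simps del: gfib.simps)
qed (simp add: gfib_nonneg)

lemma twice_gfib_mult_le_gfib_add:
  assumes "4 \<le> s"
  shows "2 * (gfib s (- t) m * gfib s (- t) r) \<le> gfib s (- t) (m + r)"
proof -
  have "2 * (gfib s (- t) m * gfib s (- t) r) \<le> (s - 2) * (gfib s (- t) m * gfib s (- t) r)"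
    using assms gfib_nonneg by (intro mult_right_mono) auto
  then show ?thesis
    using diff_two_mult_gfib_mult_le_gfib_add by (rule order_trans)
qed

lemma doubling_sequence_gfib_progression:
  assumes "4 \<le> s" and "0 < r"
  shows "doubling_sequence (gfib_progression s (- t) m r)"
proof
  show "0 \<le> gfib_progression s (- t) m r 0"
    by (simp add: gfib_progression_def gfib_nonneg)
  show "0 < gfib_progression s (- t) m r (Suc 0)"
    using assms(2) by (simp add: gfib_progression_def gfib_pos)
  fix k
  have "2 * gfib s (- t) (m + r * k) * 1 \<le> 2 * gfib s (- t) (m + r * k) * gfib s (- t) r"
    using gfib_pos[OF assms(2)] gfib_nonneg by (intro mult_left_mono) simp_all
  then show "2 * gfib_progression s (- t) m r k \<le> gfib_progression s (- t) m r (Suc k)"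
    using twice_gfib_mult_le_gfib_add[OF assms(1), of "m + r * k" r]
    unfolding gfib_progression_Suc by (simp add: gfib_progression_def)
qed

lemma turanian_gfib_progression_pos:
  assumes "0 < r"
  shows "0 < turanian (gfib_progression s (- t) m r) k"
  using t_pos gfib_pos[OF assms] by (simp add: turanian_gfib_progression)

lemma twice_turanian_gfib_progression_le:
  assumes "4 \<le> s"
  shows "2 * turanian (gfib_progression s (- t) m r) k \<le> gfib_progression s (- t) m r (Suc (Suc k))"
proof -
  have "2 * turanian (gfib_progression s (- t) m r) k
      = 2 * (t ^ (m + r * k) * gfib s (- t) r * gfib s (- t) r)"
    by (simp add: turanian_gfib_progression power2_eq_square)
  also have "\<dots> \<le> 2 * (gfib s (- t) (m + r * k + r) * gfib s (- t) r)"
    using power_mult_gfib_le_gfib_add gfib_nonneg by (intro mult_left_mono mult_right_mono) simp_all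
  also have "\<dots> \<le> gfib s (- t) (m + r * k + r + r)"
    using assms by (rule twice_gfib_mult_le_gfib_add)
  finally show ?thesis
    by (simp add: gfib_progression_def algebra_simps)
qed

end

lemma summable_reciprocal_gfib:
  fixes s t :: int
  assumes "0 < t" and "t < s" and "4 \<le> s" and "0 < r"
  shows "summable (\<lambda>k. 1 / real_of_int (gfib s (- t) (m + r * Suc k)))"
  using summable_reciprocal[OF doubling_sequence_of_int,
      OF doubling_sequence_gfib_progression, OF assms]
  unfolding gfib_progression_def .

lemma floor_inverse_suminf_reciprocal_gfib:
  fixes s t :: int
  assumes "0 < t" and "t < s" and "4 \<le> s" and "0 < r"
  shows "\<lfloor>inverse (\<Sum>k. 1 / real_of_int (gfib s (- t) (m + r * Suc k)))\<rfloor>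
    = gfib s (- t) (m + r) - gfib s (- t) m - 1"
proof -
  have "\<lfloor>inverse (\<Sum>k. 1 / real_of_int (gfib_progression s (- t) m r (Suc k)))\<rfloor>
      = gfib_progression s (- t) m r (Suc 0) - gfib_progression s (- t) m r 0 - 1"
    using assms
    by (intro floor_inverse_suminf_reciprocal doubling_sequence_gfib_progression
        turanian_gfib_progression_pos twice_turanian_gfib_progression_le)
  then show ?thesis
    by (simp add: gfib_progression_def)
qed

context
  fixes s :: int and r :: nat
  assumes s_ge: "4 \<le> s" and r_pos: "0 < r"
begin

lemma doubling_sequence_gfib_progression_square:
  "doubling_sequence (\<lambda>k. (gfib_progression s (-1) m r k)\<^sup>2)"
  using doubling_sequence_gfib_progression[of 1] s_ge r_pos
  by (intro doubling_sequence.doubling_sequence_square) simp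

lemma summable_reciprocal_gfib_square:
  "summable (\<lambda>k. 1 / (real_of_int (gfib s (-1) (m + r * Suc k)))\<^sup>2)"
  using summable_reciprocal[OF doubling_sequence_of_int,
      OF doubling_sequence_gfib_progression_square]
  unfolding gfib_progression_def of_int_power .

lemma floor_inverse_suminf_reciprocal_gfib_square:
  "\<lfloor>inverse (\<Sum>k. 1 / (real_of_int (gfib s (-1) (m + r * Suc k)))\<^sup>2)\<rfloor>
    = (gfib s (-1) (m + r))\<^sup>2 - (gfib s (-1) m)\<^sup>2 - 1"
proof -
  define q where "q = gfib_progression s (-1) m r"
  define T where "T k = turanian q k" for k
  interpret doubling_sequence q
    unfolding q_def using doubling_sequence_gfib_progression[of 1] s_ge r_pos by simp
  have T_pos: "0 < T k" for k
    unfolding T_def q_def using turanian_gfib_progression_pos[of 1 s r] s_ge r_pos by simp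
  have T_le: "T k \<le> (q (Suc k))\<^sup>2" for k
    using nonneg by (simp add: T_def turanian_def)
  have "0 < turanian (\<lambda>k. (q k)\<^sup>2) k" for k
    using T_pos[of k] T_le[of k] by (simp add: turanian_square flip: T_def)
  moreover have "2 * turanian (\<lambda>k. (q k)\<^sup>2) k \<le> (q (Suc (Suc k)))\<^sup>2" for k
  proof -
    have "2 * turanian (\<lambda>k. (q k)\<^sup>2) k \<le> 4 * (T k * (q (Suc k))\<^sup>2)"
      by (simp add: turanian_square algebra_simps flip: T_def)
    also have "\<dots> = (2 * (q (Suc k) * gfib s (-1) r))\<^sup>2"
      by (simp add: T_def q_def turanian_gfib_progression power_mult_distrib)
    also have "\<dots> \<le> (q (Suc (Suc k)))\<^sup>2"
      using twice_gfib_mult_le_gfib_add[of 1 s "m + r * Suc k" r] s_ge nonneg[of "Suc k"]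
        gfib_nonneg[of 1 s r]
      by (intro power_mono) (simp_all add: q_def gfib_progression_def algebra_simps)
    finally show ?thesis .
  qed
  ultimately show ?thesis
    using floor_inverse_suminf_reciprocal[OF doubling_sequence_square]
    by (simp add: q_def gfib_progression_def)
qed

end

theorem theorem18:
  fixes n r :: nat
  assumes "n > 0" and "r > 0"
  shows "(\<exists>N::int. \<forall>s t::int. s > t \<and> t \<ge> N \<longrightarrow>
            t \<ge> 1 \<and> (s, -t) \<noteq> (2, -1) \<and>
            summable (\<lambda>k. 1 / real_of_int (gfib s (-t) (r * (n + k)))) \<and>
            \<lfloor>inverse (\<Sum>k. 1 / real_of_int (gfib s (-t) (r * (n + k))))\<rfloor>
              = gfib s (-t) (r * n) - gfib s (-t) (r * (n - 1)) - 1)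
       \<and> (\<exists>S::int. \<forall>s::int. s \<ge> S \<longrightarrow>
            summable (\<lambda>k. 1 / (real_of_int (gfib s (-1) (r * (n + k))))\<^sup>2) \<and>
            \<lfloor>inverse (\<Sum>k. 1 / (real_of_int (gfib s (-1) (r * (n + k))))\<^sup>2)\<rfloor>
              = (gfib s (-1) (r * n))\<^sup>2 - (gfib s (-1) (r * (n - 1)))\<^sup>2 - 1)"
proof -
  obtain m where n: "n = Suc m"
    using assms(1) gr0_implies_Suc by blast
  have progression: "r * (n + k) = r * m + r * Suc k" for k
    by (simp add: n algebra_simps)
  have endpoints: "r * n = r * m + r" "r * (n - 1) = r * m"
    by (simp_all add: n)
  show ?thesis
    unfolding progression endpoints
  proof (rule conjI; rule exI[of _ "4::int"]; intro allI impI conjI)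
    fix s t :: int
    assume "s > t \<and> t \<ge> 4"
    then show "summable (\<lambda>k. 1 / real_of_int (gfib s (-t) (r * m + r * Suc k)))"
      and "\<lfloor>inverse (\<Sum>k. 1 / real_of_int (gfib s (-t) (r * m + r * Suc k)))\<rfloor>
        = gfib s (-t) (r * m + r) - gfib s (-t) (r * m) - 1"
      using assms(2) summable_reciprocal_gfib[of t s r "r * m"]
        floor_inverse_suminf_reciprocal_gfib[of t s r "r * m"] by auto
  qed (use assms(2) summable_reciprocal_gfib_square floor_inverse_suminf_reciprocal_gfib_square
      in auto)
qed

end
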